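(* Let $\mathbb{X}$ be a real normed linear space and $x,y\in\mathbb{X}$. Then the following are true: (i) $y\in x^{+}$ if and only if there exists a s.i.p. $[\cdot,\cdot]$ on $\mathbb{X}$ such that $[y,x]\ge 0$. (ii) $y\in x^{-}$ if and only if there exists a s.i.p. $[\cdot,\cdot]$ on $\mathbb{X}$ such that $[y,x]\le 0$.
   Context: For $x,y$ in a real normed space $\mathbb{X}$: $y\in x^{+}$ means $\|x+\lambda y\|\ge\|x\|$ for all $\lambda\ge 0$; $y\in x^{-}$ means $\|x+\lambda y\|\ge\|x\|$ for all $\lambda\le 0$. A semi-inner-product (s.i.p.) on a real normed space $\mathbb{X}$ is a function $[\cdot,\cdot]:\mathbb{X}\times\mathbb{X}\to\mathbb{R}$ such that for all $\alpha,\beta\in\mathbb{R}$ and $x,y,z\in\mathbb{X}$: (a) $[\alpha x+\beta y,z]=\alpha[x,z]+\beta[y,z]$; (b) $[x,x]>0$ whenever $x\ne 0$; (c) $|[x,y]|^2\le[x,x][y,y]$; (d) $[x,\alpha y]=\alpha[x,y]$. Every s.i.p. on a normed space is assumed compatible with the norm: $[x,x]=\|x\|^2$ for all $x\in\mathbb{X}$. *)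

theory Defs
  imports Complex_Main
begin

text \<open>The sets \<open>x\<^sup>+\<close> and \<open>x\<^sup>-\<close>.\<close>

definition plus_part :: "'a::real_normed_vector \<Rightarrow> 'a set" where
  "plus_part x = {y. \<forall>c::real. c \<ge> 0 \<longrightarrow> norm (x + c *\<^sub>R y) \<ge> norm x}"

definition minus_part :: "'a::real_normed_vector \<Rightarrow> 'a set" where
  "minus_part x = {y. \<forall>c::real. c \<le> 0 \<longrightarrow> norm (x + c *\<^sub>R y) \<ge> norm x}"

text \<open>
  A semi-inner-product is linear in its first argument and homogeneous, but in general
  neither additive in its second argument nor symmetric. As is customary on normed spaces,
  the last clause includes compatibility with the given norm.
\<close>

definition semi_inner_product :: "('a::real_normed_vector \<Rightarrow> 'a \<Rightarrow> real) \<Rightarrow> bool" where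
  "semi_inner_product s \<longleftrightarrow>
     (\<forall>\<alpha> \<beta> x y z. s (\<alpha> *\<^sub>R x + \<beta> *\<^sub>R y) z = \<alpha> * s x z + \<beta> * s y z) \<and>
     (\<forall>x. x \<noteq> 0 \<longrightarrow> s x x > 0) \<and>
     (\<forall>x y. \<bar>s x y\<bar>\<^sup>2 \<le> s x x * s y y) \<and>
     (\<forall>\<alpha> x y. s x (\<alpha> *\<^sub>R y) = \<alpha> * s x y) \<and>
     (\<forall>x. s x x = (norm x)\<^sup>2)"

end

theory Submission
  imports Defs
begin

text \<open>
  If \<open>y \<in> x\<^sup>+\<close>, then \<open>u \<mapsto> inf {\<parallel>u + t y\<parallel> | t \<ge> 0}\<close> is a sublinear functional below the norm
  which still takes the value \<open>\<parallel>x\<parallel>\<close> at \<open>x\<close>. A linear functional \<open>f\<close> below it with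
  \<open>f x = \<parallel>x\<parallel>\<close> is a norming functional of \<open>x\<close> with \<open>f y \<ge> 0\<close>. It exists by the
  Hahn--Banach theorem, obtained here from the fact that minimal sublinear functionals are
  linear. Choosing a norming functional \<open>F\<close> for every line, with \<open>f\<close> for the
  line through \<open>x\<close>, the formula \<open>[u, v] = F v * F u\<close>, with \<open>F\<close> belonging to the line through \<open>v\<close>,
  defines a semi-inner-product: it does not change when \<open>F\<close> is replaced by \<open>- F\<close>, so
  homogeneity in \<open>v\<close> is automatic.
\<close>

section \<open>Sublinear functionals and the Hahn-Banach theorem\<close>

definition sublinear :: "('a::real_vector \<Rightarrow> real) \<Rightarrow> bool" where
  "sublinear q \<longleftrightarrow> (\<forall>u v. q (u + v) \<le> q u + q v) \<and> (\<forall>t u. 0 \<le> t \<longrightarrow> q (t *\<^sub>R u) = t * q u)"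

lemma sublinear_add: "sublinear q \<Longrightarrow> q (u + v) \<le> q u + q v"
  by (simp add: sublinear_def)

lemma sublinear_scale: "sublinear q \<Longrightarrow> 0 \<le> t \<Longrightarrow> q (t *\<^sub>R u) = t * q u"
  by (simp add: sublinear_def)

lemma sublinear_0: "sublinear q \<Longrightarrow> q 0 = 0"
  using sublinear_scale[of q 0 0] by simp

lemma sublinear_neg: "sublinear q \<Longrightarrow> - q (- v) \<le> q v"
  using sublinear_add[of q v "- v"] sublinear_0[of q] by simp

lemma sublinear_norm: "sublinear norm"
  by (simp add: sublinear_def norm_triangle_ineq)

text \<open>The upper bound with factor \<open>inverse t\<close>, applied at
  \<open>t *\<^sub>R u\<close>, yields the reverse inequality. For an infimum, only the upper bound
  has to be checked.\<close>

lemma sublinearI: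
  assumes add: "\<And>u v. q (u + v) \<le> q u + q v"
    and scale: "\<And>t u. 0 < t \<Longrightarrow> q (t *\<^sub>R u) \<le> t * q u"
    and zero: "q 0 \<le> 0"
  shows "sublinear q"
proof -
  have q0: "q 0 = 0"
    using add[of 0 0] zero by simp
  have "q (t *\<^sub>R u) = t * q u" if "0 \<le> t" for t u
  proof (cases "t = 0")
    case True
    then show ?thesis by (simp add: q0)
  next
    case False
    with that have t: "0 < t" by simp
    then have "q u \<le> inverse t * q (t *\<^sub>R u)"
      using scale[of "inverse t" "t *\<^sub>R u"] by simp
    then have "t * q u \<le> q (t *\<^sub>R u)"
      using t by (simp add: field_simps)
    with scale[OF t, of u] show ?thesis by simp
  qed
  with add show ?thesis by (simp add: sublinear_def)
qed

text \<open>The condition on \<open>c\<close> keeps the infimum over the ray finite. Any linear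
  \<open>f\<close> below \<open>r\<close> has \<open>f y\<close> at least \<open>c\<close>, since
  \<open>f (- y)\<close> is at most \<open>- c\<close>. The last clause is the means of bounding
  \<open>r\<close> from below.\<close>

lemma sublinear_ray_inf:
  fixes q :: "'a::real_vector \<Rightarrow> real"
  assumes q: "sublinear q" and c: "c \<le> q y"
  obtains r where "sublinear r" "r \<le> q" "r (- y) \<le> - c"
    "\<And>m v. (\<And>t. 0 \<le> t \<Longrightarrow> m \<le> q (v + t *\<^sub>R y) - t * c) \<Longrightarrow> m \<le> r v"
proof -
  define r where "r v = (INF t\<in>{0..}. q (v + t *\<^sub>R y) - t * c)" for v
  have lower: "- q (- v) \<le> q (v + t *\<^sub>R y) - t * c" if "0 \<le> t" for v t
  proof -
    have "t * c \<le> q (t *\<^sub>R y)"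
      using that c by (simp add: sublinear_scale[OF q] mult_left_mono)
    also have "\<dots> \<le> q (v + t *\<^sub>R y) + q (- v)"
      using sublinear_add[OF q, of "v + t *\<^sub>R y" "- v"] by simp
    finally show ?thesis by simp
  qed
  have le: "r v \<le> q (v + t *\<^sub>R y) - t * c" if "0 \<le> t" for v t
    unfolding r_def using that lower by (intro cINF_lower bdd_belowI2) auto
  have greatest: "m \<le> r v" if "\<And>t. 0 \<le> t \<Longrightarrow> m \<le> q (v + t *\<^sub>R y) - t * c" for m v
    unfolding r_def using that by (intro cINF_greatest) auto
  have "sublinear r"
  proof (rule sublinearI)
    fix u v
    \<comment> \<open>The parameters \<open>a\<close> and \<open>b\<close> vary independently and
      their sum is admissible for \<open>u + v\<close>. The infimum is then taken over
      \<open>b\<close> and afterwards over \<open>a\<close>.\<close>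
    have "r (u + v) - (q (u + a *\<^sub>R y) - a * c) \<le> q (v + b *\<^sub>R y) - b * c"
      if "0 \<le> a" "0 \<le> b" for a b
    proof -
      have "r (u + v) \<le> q ((u + v) + (a + b) *\<^sub>R y) - (a + b) * c"
        using that by (intro le) simp
      also have "(u + v) + (a + b) *\<^sub>R y = (u + a *\<^sub>R y) + (v + b *\<^sub>R y)"
        by (simp add: algebra_simps)
      finally show ?thesis
        using sublinear_add[OF q, of "u + a *\<^sub>R y" "v + b *\<^sub>R y"] by (simp add: algebra_simps)
    qed
    then have "r (u + v) - (q (u + a *\<^sub>R y) - a * c) \<le> r v" if "0 \<le> a" for a
      using that by (intro greatest) auto
    then have "r (u + v) - r v \<le> q (u + a *\<^sub>R y) - a * c" if "0 \<le> a" for a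
      using that by (simp add: algebra_simps)
    then have "r (u + v) - r v \<le> r u"
      by (intro greatest) auto
    then show "r (u + v) \<le> r u + r v" by simp
  next
    fix s :: real and u
    assume s: "0 < s"
    have "inverse s * r (s *\<^sub>R u) \<le> q (u + t *\<^sub>R y) - t * c" if "0 \<le> t" for t
    proof -
      have "r (s *\<^sub>R u) \<le> q (s *\<^sub>R u + (s * t) *\<^sub>R y) - (s * t) * c"
        using s that by (intro le) simp
      also have "s *\<^sub>R u + (s * t) *\<^sub>R y = s *\<^sub>R (u + t *\<^sub>R y)"
        by (simp add: algebra_simps)
      also have "q \<dots> = s * q (u + t *\<^sub>R y)"
        using s by (intro sublinear_scale[OF q]) simp
      finally show ?thesis
        using s by (simp add: field_simps)
    qed
    then have "inverse s * r (s *\<^sub>R u) \<le> r u"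
      by (rule greatest)
    then show "r (s *\<^sub>R u) \<le> s * r u"
      using s by (simp add: field_simps)
  next
    show "r 0 \<le> 0"
      using le[of 0 0] sublinear_0[OF q] by simp
  qed
  moreover have "r \<le> q"
    using le[of 0] by (simp add: le_fun_def)
  moreover have "r (- y) \<le> - c"
    using le[of 1 "- y"] sublinear_0[OF q] by simp
  ultimately show ?thesis
    using that greatest by blast
qed

text \<open>Supplies the lower bounds for Zorn's lemma. The pointwise infimum is finite because
  every member is at least \<open>- p (- v)\<close> at \<open>v\<close>.\<close>

lemma sublinear_chain_inf:
  fixes C :: "('a::real_vector \<Rightarrow> real) set"
  assumes "C \<noteq> {}" and sub: "\<And>q. q \<in> C \<Longrightarrow> sublinear q \<and> q \<le> p"
    and chain: "\<And>q r. q \<in> C \<Longrightarrow> r \<in> C \<Longrightarrow> q \<le> r \<or> r \<le> q"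
  obtains r where "sublinear r" "\<And>q. q \<in> C \<Longrightarrow> r \<le> q"
proof -
  define r where "r v = (INF q\<in>C. q v)" for v
  have lower: "- p (- v) \<le> q v" if "q \<in> C" for q v
  proof -
    have "q (- v) \<le> p (- v)"
      using sub[OF that] by (simp add: le_fun_def)
    then show ?thesis
      using sublinear_neg[of q v] sub[OF that] by simp
  qed
  have le: "r v \<le> q v" if "q \<in> C" for v q
    unfolding r_def using that lower by (intro cINF_lower bdd_belowI2) auto
  have greatest: "m \<le> r v" if "\<And>q. q \<in> C \<Longrightarrow> m \<le> q v" for m v
    unfolding r_def using that \<open>C \<noteq> {}\<close> by (intro cINF_greatest) auto
  have "sublinear r"
  proof (rule sublinearI)
    fix u v
    have "r (u + v) \<le> f u + g v" if f: "f \<in> C" and g: "g \<in> C" for f g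
    proof -
      \<comment> \<open>The smaller of \<open>f\<close> and \<open>g\<close> serves as
        \<open>h\<close>; this is where the chain condition enters.\<close>
      obtain h where h: "h \<in> C" "h \<le> f" "h \<le> g"
        using chain[OF f g] f g by auto
      have "r (u + v) \<le> h (u + v)"
        using h by (intro le)
      also have "\<dots> \<le> h u + h v"
        using sub[OF h(1)] by (simp add: sublinear_add)
      also have "\<dots> \<le> f u + g v"
        using h by (intro add_mono) (simp_all add: le_fun_def)
      finally show ?thesis .
    qed
    then have "r (u + v) - f u \<le> r v" if "f \<in> C" for f
      using that by (intro greatest) (simp add: diff_le_eq add.commute[of _ "f u"])
    then have "r (u + v) - r v \<le> r u"
      by (intro greatest) (simp add: algebra_simps)
    then show "r (u + v) \<le> r u + r v" by simp
  next
    fix s :: real and u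
    assume s: "0 < s"
    have "inverse s * r (s *\<^sub>R u) \<le> q u" if "q \<in> C" for q
      using le[OF that, of "s *\<^sub>R u"] sub[OF that] s
      by (simp add: sublinear_scale field_simps)
    then have "inverse s * r (s *\<^sub>R u) \<le> r u"
      by (rule greatest)
    then show "r (s *\<^sub>R u) \<le> s * r u"
      using s by (simp add: field_simps)
  next
    obtain q where "q \<in> C" using \<open>C \<noteq> {}\<close> by auto
    then show "r 0 \<le> 0"
      using le[of q 0] sub[of q] sublinear_0[of q] by simp
  qed
  moreover have "r \<le> q" if "q \<in> C" for q
    using le[OF that] by (simp add: le_fun_def)
  ultimately show ?thesis
    using that by blast
qed

text \<open>Lowering \<open>q\<close> along \<open>y\<close> with \<open>c = q y\<close> cannot
  change it, by minimality. Hence \<open>q (- y) \<le> - q y\<close>, so \<open>q\<close> is odd,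
  and an odd sublinear functional is linear.\<close>

lemma minimal_sublinear_imp_linear:
  fixes q :: "'a::real_vector \<Rightarrow> real"
  assumes q: "sublinear q" and minimal: "\<And>r. sublinear r \<Longrightarrow> r \<le> q \<Longrightarrow> r = q"
  shows "linear q"
proof -
  have neg: "q (- y) = - q y" for y
  proof -
    obtain r where "sublinear r" "r \<le> q" "r (- y) \<le> - q y"
      using sublinear_ray_inf[OF q order_refl] by metis
    with minimal have "q (- y) \<le> - q y" by blast
    with sublinear_neg[OF q, of y] show ?thesis by simp
  qed
  show ?thesis
  proof (rule linearI)
    fix u v
    have "q (- u + - v) \<le> q (- u) + q (- v)"
      by (rule sublinear_add[OF q])
    then have "q u + q v \<le> q (u + v)"
      using neg[of "u + v"] by (simp add: neg)
    with sublinear_add[OF q, of u v] show "q (u + v) = q u + q v" by simp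
  next
    fix t :: real and u
    show "q (t *\<^sub>R u) = t *\<^sub>R q u"
    proof (cases "0 \<le> t")
      case True
      then show ?thesis by (simp add: sublinear_scale[OF q])
    next
      case False
      then have "q ((- t) *\<^sub>R u) = - t * q u"
        by (intro sublinear_scale[OF q]) simp
      then show ?thesis
        using neg[of "t *\<^sub>R u"] by simp
    qed
  qed
qed

text \<open>A form of Hahn-Banach without a subspace: prescribed values are imposed by lowering
  \<open>p\<close> along rays beforehand.\<close>

theorem sublinear_dominates_linear:
  fixes p :: "'a::real_vector \<Rightarrow> real"
  assumes p: "sublinear p"
  obtains f where "linear f" "f \<le> p"
proof -
  let ?A = "{q. sublinear q \<and> q \<le> p}"
  \<comment> \<open>The order is reversed, so that the maximal element given by Zorn's lemma is a
    minimal functional.\<close>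
  let ?P = "\<lambda>f g :: 'a \<Rightarrow> real. g \<le> f"
  have "partial_order_on ?A (relation_of ?P ?A)"
    by (rule partial_order_on_relation_ofI) auto
  moreover have "\<exists>u\<in>?A. \<forall>q\<in>C. u \<le> q" if C: "C \<in> Chains (relation_of ?P ?A)" for C
  proof (cases "C = {}")
    case True
    with p show ?thesis by auto
  next
    case False
    have sub: "q \<in> C \<Longrightarrow> sublinear q \<and> q \<le> p" for q
      using C unfolding Chains_def relation_of_def by auto
    have "q \<in> C \<Longrightarrow> r \<in> C \<Longrightarrow> q \<le> r \<or> r \<le> q" for q r
      using C unfolding Chains_def relation_of_def by auto
    from sublinear_chain_inf[OF False sub this]
    obtain r where r: "sublinear r" "\<And>q. q \<in> C \<Longrightarrow> r \<le> q" by blast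
    moreover obtain q where "q \<in> C" using False by auto
    ultimately have "r \<le> p" using sub order_trans by blast
    with r show ?thesis by blast
  qed
  ultimately obtain q where q: "q \<in> ?A" "\<And>r. r \<in> ?A \<Longrightarrow> r \<le> q \<Longrightarrow> r = q"
    using predicate_Zorn[of ?A ?P] by blast
  have "linear q"
  proof (rule minimal_sublinear_imp_linear)
    show "sublinear q" using q by simp
    show "r = q" if "sublinear r" "r \<le> q" for r
      using q that order_trans by blast
  qed
  with q that show ?thesis by blast
qed

section \<open>Norming functionals\<close>

lemma plus_part_norming_functional:
  fixes x y :: "'a::real_normed_vector"
  assumes y: "y \<in> plus_part x"
  obtains f where "linear f" "\<And>v. \<bar>f v\<bar> \<le> norm v" "f x = norm x" "0 \<le> f y"
proof -
  obtain r where r: "sublinear r" "r \<le> norm" "r (- y) \<le> - 0"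
    and inf: "\<And>m v. (\<And>t. 0 \<le> t \<Longrightarrow> m \<le> norm (v + t *\<^sub>R y) - t * 0) \<Longrightarrow> m \<le> r v"
    using sublinear_ray_inf[OF sublinear_norm norm_ge_zero] by blast
  \<comment> \<open>On the ray from \<open>x\<close> in direction \<open>y\<close> the norm never
    drops below \<open>norm x\<close>. This permits a second lowering, along \<open>x\<close> with
    \<open>c = norm x\<close>.\<close>
  have "norm x \<le> r x"
    using y by (intro inf) (simp add: plus_part_def)
  from sublinear_ray_inf[OF r(1) this]
  obtain q where q: "sublinear q" "q \<le> r" "q (- x) \<le> - norm x" by metis
  from sublinear_dominates_linear[OF q(1)]
  obtain f where f: "linear f" "f \<le> q" by blast
  have "f \<le> r" using f q by (rule_tac order_trans)
  have le: "f v \<le> norm v" for v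
    using \<open>f \<le> r\<close> r(2) by (meson le_funD order_trans)
  have neg: "f (- v) = - f v" for v
    using f(1) by (rule linear_neg)
  have "\<bar>f v\<bar> \<le> norm v" for v
    using le[of v] le[of "- v"] by (simp add: neg abs_le_iff)
  moreover have "norm x \<le> f x"
    using le_funD[OF f(2), of "- x"] q(3) by (simp add: neg)
  then have "f x = norm x"
    using le[of x] by simp
  moreover have "0 \<le> f y"
    using le_funD[OF \<open>f \<le> r\<close>, of "- y"] r(3) by (simp add: neg)
  ultimately show ?thesis
    using f(1) that by blast
qed

section \<open>Semi-inner-products from norming functionals\<close>

definition norming_on :: "'a::real_normed_vector set \<Rightarrow> ('a \<Rightarrow> real) \<Rightarrow> bool" where
  "norming_on L f \<longleftrightarrow> linear f \<and> (\<forall>v. \<bar>f v\<bar> \<le> norm v) \<and> (\<forall>v\<in>L. \<bar>f v\<bar> = norm v)"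

text \<open>The absolute value makes norming a property of the line, whichever generator and sign
  are chosen.\<close>

lemma norming_on_span:
  assumes "linear f" "\<And>v. \<bar>f v\<bar> \<le> norm v" "f x = norm x"
  shows "norming_on (span {x}) f"
  using assms by (auto simp: norming_on_def span_singleton linear_scale abs_mult)

text \<open>Indexing by spans gives \<open>v\<close> and its nonzero multiples the same functional,
  so homogeneity in \<open>v\<close> reduces to linearity. Cauchy-Schwarz follows by bounding each
  factor by a norm.\<close>

lemma semi_inner_product_of_norming:
  assumes F: "\<And>v. norming_on (span {v}) (F (span {v}))"
  shows "semi_inner_product (\<lambda>u v. F (span {v}) v * F (span {v}) u)"
proof -
  have lin: "linear (F (span {v}))" for v
    using F[of v] by (simp add: norming_on_def)
  have bound: "\<bar>F (span {v}) u\<bar> \<le> norm u" for u v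
    using F[of v] by (simp add: norming_on_def)
  have "\<bar>F (span {v}) v\<bar> = norm v" for v
    using F[of v] by (simp add: norming_on_def span_base)
  then have sq: "F (span {v}) v * F (span {v}) v = (norm v)\<^sup>2" for v
    by (metis power2_abs power2_eq_square)
  have scale: "F (span {\<alpha> *\<^sub>R v}) (\<alpha> *\<^sub>R v) * F (span {\<alpha> *\<^sub>R v}) u
      = \<alpha> * (F (span {v}) v * F (span {v}) u)" for \<alpha> u v
  proof (cases "\<alpha> = 0")
    case True
    then show ?thesis using linear_0[OF lin[of 0]] by simp
  next
    case False
    then have "span {\<alpha> *\<^sub>R v} = span {v}"
      by (simp add: span_image_scale[of "{v}" "\<lambda>_. \<alpha>", simplified])
    then show ?thesis by (simp add: linear_scale[OF lin])
  qed
  have cs: "\<bar>F (span {v}) v * F (span {v}) u\<bar>\<^sup>2 \<le> (norm u)\<^sup>2 * (norm v)\<^sup>2" for u v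
    using mult_mono[OF bound[of v v] bound[of v u]]
    by (simp add: abs_mult mult.commute flip: power_mult_distrib)
  show ?thesis
    unfolding semi_inner_product_def sq
  proof (intro conjI allI impI)
    show "F (span {z}) z * F (span {z}) (\<alpha> *\<^sub>R u + \<beta> *\<^sub>R v)
        = \<alpha> * (F (span {z}) z * F (span {z}) u) + \<beta> * (F (span {z}) z * F (span {z}) v)"
      for \<alpha> \<beta> u v z
      by (simp add: linear_add[OF lin] linear_scale[OF lin] algebra_simps)
    show "0 < (norm v)\<^sup>2" if "v \<noteq> 0" for v :: 'a
      using that by simp
    show "\<bar>F (span {v}) v * F (span {v}) u\<bar>\<^sup>2 \<le> (norm u)\<^sup>2 * (norm v)\<^sup>2" for u v
      by (rule cs)
    show "F (span {\<alpha> *\<^sub>R v}) (\<alpha> *\<^sub>R v) * F (span {\<alpha> *\<^sub>R v}) u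
        = \<alpha> * (F (span {v}) v * F (span {v}) u)" for \<alpha> u v
      by (rule scale)
  qed (rule refl)
qed

lemma plus_part_iff_semi_inner_product:
  fixes x y :: "'a::real_normed_vector"
  shows "y \<in> plus_part x \<longleftrightarrow>
    (\<exists>s :: 'a \<Rightarrow> 'a \<Rightarrow> real. semi_inner_product s \<and> 0 \<le> s y x)"
proof
  assume "y \<in> plus_part x"
  from plus_part_norming_functional[OF this]
  obtain f where f: "linear f" "\<And>v. \<bar>f v\<bar> \<le> norm v" "f x = norm x" "0 \<le> f y" by blast
  have "\<exists>g. norming_on (span {v}) g" for v :: 'a
  proof -
    \<comment> \<open>With direction 0 the previous construction yields a norming functional for an
      arbitrary \<open>v\<close>.\<close>
    have "0 \<in> plus_part v" by (simp add: plus_part_def)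
    from plus_part_norming_functional[OF this]
    obtain g where "linear g" "\<And>u. \<bar>g u\<bar> \<le> norm u" "g v = norm v" by blast
    then show ?thesis by (blast intro: norming_on_span)
  qed
  then have G: "norming_on (span {v}) (SOME g. norming_on (span {v}) g)" for v :: 'a
    by (rule someI_ex)
  define F where "F = (\<lambda>L. SOME g. norming_on L g)(span {x} := f)"
  have "norming_on (span {v}) (F (span {v}))" for v
  proof (cases "span {v} = span {x}")
    case True
    then show ?thesis
      using norming_on_span[OF f(1-3)] by (simp only: F_def fun_upd_same)
  next
    case False
    then show ?thesis
      using G[of v] by (simp only: F_def fun_upd_other not_False_eq_True)
  qed
  then have "semi_inner_product (\<lambda>u v. F (span {v}) v * F (span {v}) u)"
    by (rule semi_inner_product_of_norming)
  moreover have "0 \<le> F (span {x}) x * F (span {x}) y"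
    using f by (simp add: F_def)
  ultimately show "\<exists>s :: 'a \<Rightarrow> 'a \<Rightarrow> real. semi_inner_product s \<and> 0 \<le> s y x"
    by blast
next
  assume "\<exists>s :: 'a \<Rightarrow> 'a \<Rightarrow> real. semi_inner_product s \<and> 0 \<le> s y x"
  then obtain s :: "'a \<Rightarrow> 'a \<Rightarrow> real" where s: "semi_inner_product s" "0 \<le> s y x" by blast
  have lin: "s (\<alpha> *\<^sub>R u + \<beta> *\<^sub>R v) z = \<alpha> * s u z + \<beta> * s v z" for \<alpha> \<beta> u v z
    using s(1) by (simp add: semi_inner_product_def)
  have self: "s v v = (norm v)\<^sup>2" for v
    using s(1) by (simp add: semi_inner_product_def)
  \<comment> \<open>Cauchy-Schwarz bounds \<open>s (x + c *\<^sub>R y) x\<close> above by the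
    product of the norms, while \<open>s y x \<ge> 0\<close> bounds it below by the square of
    \<open>norm x\<close>. Cancelling \<open>norm x\<close> leaves the claim.\<close>
  have "norm x \<le> norm (x + c *\<^sub>R y)" if "0 \<le> c" for c
  proof -
    have "\<bar>s (x + c *\<^sub>R y) x\<bar>\<^sup>2 \<le> s (x + c *\<^sub>R y) (x + c *\<^sub>R y) * s x x"
      using s(1) unfolding semi_inner_product_def by blast
    then have "\<bar>s (x + c *\<^sub>R y) x\<bar>\<^sup>2 \<le> (norm (x + c *\<^sub>R y) * norm x)\<^sup>2"
      by (simp add: self power_mult_distrib)
    then have "\<bar>s (x + c *\<^sub>R y) x\<bar> \<le> norm (x + c *\<^sub>R y) * norm x"
      by (rule power2_le_imp_le) simp
    moreover have "norm x * norm x \<le> s (x + c *\<^sub>R y) x"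
      using lin[of 1 x c y x] s(2) that by (simp add: self power2_eq_square)
    ultimately have "norm x * norm x \<le> norm (x + c *\<^sub>R y) * norm x" by simp
    then show ?thesis
      by (cases "x = 0") auto
  qed
  then show "y \<in> plus_part x" by (simp add: plus_part_def)
qed

section \<open>Reflection from the plus part to the minus part\<close>

lemma minus_part_iff_plus_part: "y \<in> minus_part x \<longleftrightarrow> - y \<in> plus_part x"
proof
  assume y: "y \<in> minus_part x"
  have "norm x \<le> norm (x + c *\<^sub>R - y)" if "0 \<le> c" for c
    using y that by (auto simp: minus_part_def dest: spec[of _ "- c"])
  then show "- y \<in> plus_part x" by (simp add: plus_part_def)
next
  assume y: "- y \<in> plus_part x"
  have "norm x \<le> norm (x + c *\<^sub>R y)" if "c \<le> 0" for c
    using y that by (auto simp: plus_part_def dest: spec[of _ "- c"])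
  then show "y \<in> minus_part x" by (simp add: minus_part_def)
qed

lemma semi_inner_product_minus_left:
  assumes "semi_inner_product s"
  shows "s (- y) x = - s y x"
proof -
  have "s ((-1) *\<^sub>R y + 0 *\<^sub>R y) x = (-1) * s y x + 0 * s y x"
    using assms unfolding semi_inner_product_def by blast
  then show ?thesis by simp
qed

theorem theorem2p4:
  fixes x y :: "'a::real_normed_vector"
  shows "(y \<in> plus_part x \<longleftrightarrow>
            (\<exists>s :: 'a \<Rightarrow> 'a \<Rightarrow> real. semi_inner_product s \<and> s y x \<ge> 0)) \<and>
         (y \<in> minus_part x \<longleftrightarrow>
            (\<exists>s :: 'a \<Rightarrow> 'a \<Rightarrow> real. semi_inner_product s \<and> s y x \<le> 0))"
proof -
  \<comment> \<open>The same \<open>s\<close> serves for \<open>y\<close> and \<open>- y\<close>, so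
    the second equivalence is the first one at \<open>- y\<close>.\<close>
  have "semi_inner_product s \<and> 0 \<le> s (- y) x \<longleftrightarrow> semi_inner_product s \<and> s y x \<le> 0"
    for s :: "'a \<Rightarrow> 'a \<Rightarrow> real"
    using semi_inner_product_minus_left[of s y x] by auto
  then show ?thesis
    by (simp only: plus_part_iff_semi_inner_product minus_part_iff_plus_part)
qed

end
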